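(* Let $G$ be a connected graph with $|G|\ge 2$ and let $H$ be an arbitrary graph with $|H|=n$. Then the lexicographic product $G[H]$ is distance preserving if and only if $b\le an+1$ for every pair $a,b\in \mathrm{dp}(G)$ (with $a<b$) bounding a non-dp interval.
   Context: All graphs are finite, undirected and simple, with nonempty vertex set; $|G|$ denotes the number of vertices of $G$. The distance $d_G(u,v)$ is the minimum length (number of edges) of a path from $u$ to $v$ in $G$, and $d_G(u,v)=\infty$ if no such path exists. A subgraph $K$ of $G$ is isometric, written $K\le G$, if $d_K(u,v)=d_G(u,v)$ for every pair of vertices $u,v\in V(K)$. A graph $G$ is distance preserving (dp) if it is connected and has an isometric subgraph with exactly $i$ vertices for every $1\le i\le |G|$. The lexicographic product $G[H]$ is the graph with vertex set $V(G)\times V(H)$ and edge set $E(G[H])=\{(u,x)(v,y) : uv\in E(G),\text{ or } (xy\in E(H)\text{ and }u=v)\}$. $\mathrm{dp}(G)=\{k\ge 1 : G \text{ has an isometric subgraph with } k \text{ vertices}\}$. Two elements $a<b$ of $\mathrm{dp}(G)$ bound a non-dp interval if the set of integers $c$ with $a<c<b$ is nonempty and consists only of elements not in $\mathrm{dp}(G)$. *)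

theory Defs
  imports "Graph_Theory.Graph_Theory" "HOL-Library.Extended_Nat"
begin

text \<open>
  Finite simple graphs are represented by \<^locale>\<open>pair_graph\<close>: an undirected edge \<open>uv\<close> is the
  pair of arcs \<open>(u, v)\<close>, \<open>(v, u)\<close>. This locale admits the empty graph, so nonemptiness of the
  vertex set has to be stated separately.
\<close>

text \<open>In \<^typ>\<open>enat\<close> the infimum of the empty set is \<open>\<infinity>\<close>, the distance when there is no path.\<close>

definition gdist :: "'a pair_pre_digraph \<Rightarrow> 'a \<Rightarrow> 'a \<Rightarrow> enat" where
  "gdist G u v = (INF p \<in> {p. pre_digraph.apath (with_proj G) u p v}. enat (length p))"

text \<open>
  A subgraph need not be induced. Since \<^const>\<open>subgraph\<close> is a notion for digraphs, it has to be
  required in addition that \<open>K\<close> is an undirected graph.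
\<close>

definition isometric_subgraph :: "'a pair_pre_digraph \<Rightarrow> 'a pair_pre_digraph \<Rightarrow> bool" where
  "isometric_subgraph K G \<longleftrightarrow> pair_graph K \<and> subgraph (with_proj K) (with_proj G) \<and>
     (\<forall>u \<in> pverts K. \<forall>v \<in> pverts K. gdist K u v = gdist G u v)"

definition dp_set :: "'a pair_pre_digraph \<Rightarrow> nat set" where
  "dp_set G = {k. k \<ge> 1 \<and> (\<exists>K. isometric_subgraph K G \<and> card (pverts K) = k)}"

definition distance_preserving :: "'a pair_pre_digraph \<Rightarrow> bool" where
  "distance_preserving G \<longleftrightarrow> Digraph_Component.connected (with_proj G) \<and>
     (\<forall>i. 1 \<le> i \<and> i \<le> card (pverts G) \<longrightarrow>
        (\<exists>K. isometric_subgraph K G \<and> card (pverts K) = i))"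

definition bounds_non_dp_interval :: "'a pair_pre_digraph \<Rightarrow> nat \<Rightarrow> nat \<Rightarrow> bool" where
  "bounds_non_dp_interval G a b \<longleftrightarrow> a \<in> dp_set G \<and> b \<in> dp_set G \<and> a < b \<and>
     {a<..<b} \<noteq> {} \<and> {a<..<b} \<inter> dp_set G = {}"

definition lex_product ::
  "'a pair_pre_digraph \<Rightarrow> 'b pair_pre_digraph \<Rightarrow> ('a \<times> 'b) pair_pre_digraph" where
  "lex_product G H = \<lparr> pverts = pverts G \<times> pverts H,
     parcs = {((u, x), (v, y)) | u x v y.
       (u, x) \<in> pverts G \<times> pverts H \<and> (v, y) \<in> pverts G \<times> pverts H \<and>
       ((u, v) \<in> parcs G \<or> (x, y) \<in> parcs H \<and> u = v)} \<rparr>"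

lemma pair_graph_lex_product:
  assumes "pair_graph G" "pair_graph H"
  shows "pair_graph (lex_product G H)"
proof -
  interpret G: pair_graph G by fact
  interpret H: pair_graph H by fact
  have fin: "finite (pverts G \<times> pverts H)"
    using G.pair_finite_verts H.pair_finite_verts by simp
  have "parcs (lex_product G H) \<subseteq> (pverts G \<times> pverts H) \<times> (pverts G \<times> pverts H)"
    by (auto simp: lex_product_def)
  then have "finite (parcs (lex_product G H))"
    using fin by (meson finite_SigmaI finite_subset)
  moreover have "symmetric (with_proj (lex_product G H))"
    unfolding symmetric_def
    by (rule symI) (auto simp: lex_product_def dest: G.arcs_symmetric H.arcs_symmetric)
  ultimately show ?thesis
    using fin by unfold_locales (auto simp: lex_product_def dest: G.no_loops' H.no_loops')
qed

end

theory Submission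
imports Defs
begin

text \<open>
  Distances in \<open>G[H]\<close> between vertices with distinct first coordinates are those of \<open>G\<close>, and
  distances inside a copy of \<open>H\<close> are at most 2. Hence an isometric subgraph of \<open>G[H]\<close> projects
  to an isometric subgraph of \<open>G\<close>, and for every isometric \<open>K \<le> G\<close> with at least two vertices any
  set of vertices of \<open>G[H]\<close> projecting onto the vertex set of \<open>K\<close> induces an isometric subgraph.
  So the orders of isometric subgraphs of \<open>G[H]\<close> are exactly the members of the intervals
  \<open>{a..a * n}\<close> with \<open>a \<in> dp(G)\<close>, and these cover \<open>{1..|G| * n}\<close> iff no two consecutive
  elements \<open>a < b\<close> of \<open>dp(G)\<close> satisfy \<open>b > a * n + 1\<close>.
\<close>

section \<open>Distances as powers of the arc relation\<close>

context pair_wf_digraph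
begin

lemma relpow_if_awalk: "awalk u p v \<Longrightarrow> (u, v) \<in> parcs G ^^ length p"
proof (induction p arbitrary: u)
  case Nil
  then show ?case by (simp add: awalk_Nil_iff)
next
  case (Cons e p)
  then have "(u, snd e) \<in> parcs G" "(snd e, v) \<in> parcs G ^^ length p"
    by (auto simp: awalk_Cons_iff)
  then have "(u, v) \<in> parcs G ^^ Suc (length p)" by (rule relpow_Suc_I2)
  then show ?case by simp
qed

lemma awalk_if_relpow:
  "u \<in> pverts G \<Longrightarrow> (u, v) \<in> parcs G ^^ k \<Longrightarrow> \<exists>p. awalk u p v \<and> length p = k"
proof (induction k arbitrary: u)
  case 0
  then show ?case by (auto simp: awalk_Nil_iff)
next
  case (Suc k)
  obtain w where w: "(u, w) \<in> parcs G" "(w, v) \<in> parcs G ^^ k"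
    using relpow_Suc_D2 Suc.prems(2) by metis
  obtain p where "awalk w p v" "length p = k"
    using Suc.IH[OF in_arcsD2[OF w(1)] w(2)] by blast
  then have "awalk u ((u, w) # p) v" "length ((u, w) # p) = Suc k"
    using w(1) by (auto simp: awalk_Cons_iff)
  then show ?case by blast
qed

text \<open>Each step of \<open>awalk_to_apath\<close> deletes a cycle \<open>r\<close> from
  \<open>p = q @ r @ s\<close>, so the length never grows.\<close>

lemma length_awalk_to_apath_le: "awalk u p v \<Longrightarrow> length (awalk_to_apath p) \<le> length p"
proof (induction rule: awalk_to_apath_induct)
  case (path p)
  then show ?case by (auto simp: awalk_to_apath.simps)
next
  case (decomp p q r s)
  then obtain u v where "awalk u p v" "\<not> distinct (awalk_verts u p)" by blast
  then have "awalk_to_apath p = awalk_to_apath (q @ s)" "is_awalk_cyc_decomp p (q, r, s)"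
    using decomp step_awalk_to_apath awalk_cyc_decomp_has_prop[of u p v] by auto
  then show ?case
    using decomp by simp
qed

text \<open>Paths may be replaced by walks, since shortcutting a walk to a path does not lengthen
  it. Infinite distance needs no separate treatment: then both sides fail for every
  \<open>k\<close>.\<close>

lemma gdist_le_iff:
  assumes "u \<in> pverts G"
  shows "gdist G u v \<le> enat k \<longleftrightarrow> (\<exists>j\<le>k. (u, v) \<in> parcs G ^^ j)"
proof
  assume le: "gdist G u v \<le> enat k"
  let ?L = "(\<lambda>p. enat (length p)) ` {p. apath u p v}"
  have "Inf ?L \<le> enat k"
    using le by (simp add: gdist_def)
  \<comment> \<open>The infimum of the empty set is \<infinity>, so a finite bound forces a path to
    exist; over a nonempty set of \<open>enat\<close> the infimum is attained.\<close>
  then have "?L \<noteq> {}"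
    by (auto simp: Inf_enat_def split: if_splits)
  then have "Inf ?L \<in> ?L"
    by (auto simp: Inf_enat_def intro: LeastI)
  then obtain p where "apath u p v" "length p \<le> k"
    using \<open>Inf ?L \<le> enat k\<close> by auto
  then show "\<exists>j\<le>k. (u, v) \<in> parcs G ^^ j"
    using relpow_if_awalk awalkI_apath by blast
next
  assume "\<exists>j\<le>k. (u, v) \<in> parcs G ^^ j"
  then obtain p where p: "awalk u p v" "length p \<le> k"
    using awalk_if_relpow[OF assms] by blast
  have "gdist G u v \<le> enat (length (awalk_to_apath p))"
    unfolding gdist_def using apath_awalk_to_apath[OF p(1)] by (auto intro: INF_lower)
  also have "\<dots> \<le> enat k"
    using length_awalk_to_apath_le[OF p(1)] p(2) by simp
  finally show "gdist G u v \<le> enat k" .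
qed

end

lemma enat_eqI_le: "(\<And>k. x \<le> enat k \<longleftrightarrow> y \<le> enat k) \<Longrightarrow> x = y"
  by (metis dual_order.antisym enat_ord_code(3) not_enat_eq order_refl)

lemma relpow_mono_rel:
  fixes R S :: "'a rel"
  shows "(x, y) \<in> R ^^ k \<Longrightarrow> R \<subseteq> S \<Longrightarrow> (x, y) \<in> S ^^ k"
  by (induction k arbitrary: y) auto

text \<open>Walks of \<open>K\<close> are walks of \<open>G\<close>, so distances in
  \<open>K\<close> are never smaller. What remains to demand is that every walk of \<open>G\<close>
  between vertices of \<open>K\<close> is matched by a walk of \<open>K\<close> that is no
  longer.\<close>

lemma isometric_subgraph_iff:
  assumes "pair_graph G"
  shows "isometric_subgraph K G \<longleftrightarrow> pair_graph K \<and> pverts K \<subseteq> pverts G \<and> parcs K \<subseteq> parcs G \<and>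
    (\<forall>u\<in>pverts K. \<forall>v\<in>pverts K. \<forall>k. (u, v) \<in> parcs G ^^ k \<longrightarrow> (\<exists>j\<le>k. (u, v) \<in> parcs K ^^ j))"
    (is "_ \<longleftrightarrow> _ \<and> _ \<and> _ \<and> ?I")
proof (cases "pair_graph K \<and> pverts K \<subseteq> pverts G \<and> parcs K \<subseteq> parcs G")
  case True
  interpret G: pair_graph G by fact
  interpret K: pair_graph K using True by blast
  have "subgraph (with_proj K) (with_proj G)"
    using True G.wf_digraph K.wf_digraph by (auto simp: subgraph_def compatible_def)
  moreover have "gdist K u v = gdist G u v \<longleftrightarrow>
      (\<forall>k. (u, v) \<in> parcs G ^^ k \<longrightarrow> (\<exists>j\<le>k. (u, v) \<in> parcs K ^^ j))"
    if "u \<in> pverts K" for u v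
  proof
    assume eq: "gdist K u v = gdist G u v"
    show "\<forall>k. (u, v) \<in> parcs G ^^ k \<longrightarrow> (\<exists>j\<le>k. (u, v) \<in> parcs K ^^ j)"
      using eq K.gdist_le_iff[of u v] G.gdist_le_iff[of u v] that True
      by (metis order_refl subsetD)
  next
    assume *: "\<forall>k. (u, v) \<in> parcs G ^^ k \<longrightarrow> (\<exists>j\<le>k. (u, v) \<in> parcs K ^^ j)"
    show "gdist K u v = gdist G u v"
    proof (rule enat_eqI_le)
      fix k
      have "(\<exists>j\<le>k. (u, v) \<in> parcs K ^^ j) \<longleftrightarrow> (\<exists>j\<le>k. (u, v) \<in> parcs G ^^ j)"
        using * True by (meson relpow_mono_rel order_trans)
      then show "gdist K u v \<le> enat k \<longleftrightarrow> gdist G u v \<le> enat k"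
        using K.gdist_le_iff[of u v] G.gdist_le_iff[of u v] that True by auto
    qed
  qed
  ultimately show ?thesis
    using True by (simp add: isometric_subgraph_def)
next
  case False
  then show ?thesis
    by (auto simp: isometric_subgraph_def subgraph_def)
qed

lemma isometric_subgraph_refl: "pair_graph G \<Longrightarrow> isometric_subgraph G G"
  by (auto simp: isometric_subgraph_iff)

section \<open>Induced isometric subgraphs and the basic elements of \<open>dp_set G\<close>\<close>

definition induced :: "'a pair_pre_digraph \<Rightarrow> 'a set \<Rightarrow> 'a pair_pre_digraph" where
  "induced G S = \<lparr>pverts = S, parcs = parcs G \<inter> S \<times> S\<rparr>"

lemma induced_simps [simp]:
  "pverts (induced G S) = S" "parcs (induced G S) = parcs G \<inter> S \<times> S"
  by (simp_all add: induced_def)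

lemma pair_graph_induced:
  assumes "pair_graph G" "S \<subseteq> pverts G"
  shows "pair_graph (induced G S)"
proof -
  interpret G: pair_graph G by fact
  have "symmetric (with_proj (induced G S))"
    unfolding symmetric_def by (rule symI) (auto dest: G.arcs_symmetric)
  then show ?thesis
    using finite_subset[OF assms(2) G.pair_finite_verts] G.pair_finite_arcs
    by unfold_locales (auto dest: G.no_loops')
qed

text \<open>The empty walk settles \<open>u = v\<close>, so only distinct vertices have to be
  checked.\<close>

lemma isometric_subgraph_inducedI:
  assumes "pair_graph G" "S \<subseteq> pverts G"
    and "\<And>u v k. u \<in> S \<Longrightarrow> v \<in> S \<Longrightarrow> u \<noteq> v \<Longrightarrow> (u, v) \<in> parcs G ^^ k \<Longrightarrow>
      \<exists>j\<le>k. (u, v) \<in> (parcs G \<inter> S \<times> S) ^^ j"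
  shows "isometric_subgraph (induced G S) G"
proof -
  have "\<exists>j\<le>k. (u, v) \<in> (parcs G \<inter> S \<times> S) ^^ j"
    if "u \<in> S" "v \<in> S" "(u, v) \<in> parcs G ^^ k" for u v k
    using that assms(3) by (cases "u = v") (auto intro: exI[of _ 0])
  then show ?thesis
    using assms(2) by (simp add: isometric_subgraph_iff[OF assms(1)] pair_graph_induced[OF assms(1)])
qed

lemma dp_setI: "isometric_subgraph K G \<Longrightarrow> card (pverts K) = k \<Longrightarrow> 1 \<le> k \<Longrightarrow> k \<in> dp_set G"
  by (auto simp: dp_set_def)

lemma dp_setE:
  assumes "k \<in> dp_set G"
  obtains K where "isometric_subgraph K G" "card (pverts K) = k" "1 \<le> k"
  using assms by (auto simp: dp_set_def)

lemma card_verts_in_dp_set: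
  assumes "pair_graph G" "pverts G \<noteq> {}"
  shows "card (pverts G) \<in> dp_set G"
proof -
  interpret pair_graph G by fact
  show ?thesis
    using assms pair_finite_verts
    by (intro dp_setI[OF isometric_subgraph_refl]) (auto simp: Suc_le_eq card_gt_0_iff)
qed

lemma dp_set_le_card:
  assumes "pair_graph G" "k \<in> dp_set G"
  shows "k \<le> card (pverts G)"
proof -
  interpret pair_graph G by fact
  obtain K where "isometric_subgraph K G" "card (pverts K) = k"
    using assms(2) by (rule dp_setE)
  then show ?thesis
    using card_mono[OF pair_finite_verts] by (auto simp: isometric_subgraph_iff[OF assms(1)])
qed

lemma one_in_dp_set:
  assumes "pair_graph G" "pverts G \<noteq> {}"
  shows "1 \<in> dp_set G"
proof -
  obtain u where "u \<in> pverts G" using assms(2) by blast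
  then have "isometric_subgraph (induced G {u}) G"
    by (intro isometric_subgraph_inducedI[OF assms(1)]) auto
  then show ?thesis by (rule dp_setI) auto
qed

text \<open>A walk between the two distinct ends of an edge has length at least 1, and the edge
  itself attains this.\<close>

lemma two_in_dp_set:
  assumes "pair_graph G" "(u, v) \<in> parcs G"
  shows "2 \<in> dp_set G"
proof -
  interpret pair_graph G by fact
  have uv: "u \<in> pverts G" "v \<in> pverts G" "u \<noteq> v" "(v, u) \<in> parcs G"
    using assms(2) by (auto dest: in_arcsD1 in_arcsD2 no_loops' arcs_symmetric)
  have "isometric_subgraph (induced G {u, v}) G"
  proof (rule isometric_subgraph_inducedI[OF assms(1)])
    fix x y k
    assume xy: "x \<in> {u, v}" "y \<in> {u, v}" "x \<noteq> y" "(x, y) \<in> parcs G ^^ k"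
    then have "(x, y) \<in> (parcs G \<inter> {u, v} \<times> {u, v}) ^^ 1"
      using uv assms(2) by auto
    moreover have "1 \<le> k"
      using xy by (cases k) auto
    ultimately show "\<exists>j\<le>k. (x, y) \<in> (parcs G \<inter> {u, v} \<times> {u, v}) ^^ j"
      by blast
  qed (use uv in auto)
  then show ?thesis
    by (rule dp_setI) (use uv in auto)
qed

section \<open>Connectedness\<close>

text \<open>\<open>connected_conv\<close> speaks of reachability along the symmetric closure of the
  arcs, which for a \<open>pair_graph\<close> is the arc relation itself.\<close>

lemma connected_iff_relpow:
  assumes "pair_graph G"
  shows "Digraph_Component.connected (with_proj G) \<longleftrightarrow>
    pverts G \<noteq> {} \<and> (\<forall>u\<in>pverts G. \<forall>v\<in>pverts G. \<exists>k. (u, v) \<in> parcs G ^^ k)"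
proof -
  interpret pair_graph G by fact
  have sym: "(parcs G)\<^sup>s = parcs G"
    by (auto simp: symcl_def dest: arcs_symmetric)
  have "(u, v) \<in> rtrancl_on (pverts G) (parcs G) \<longleftrightarrow> (\<exists>k. (u, v) \<in> parcs G ^^ k)"
    if "u \<in> pverts G" "v \<in> pverts G" for u v
    using that
    by (auto simp: rtrancl_power[symmetric] dest: rtrancl_on_rtranclI in_arcsD2
      intro: rtrancl_consistent_rtrancl_on)
  then show ?thesis
    by (simp add: connected_conv sym)
qed

lemma ex_neighbour:
  fixes R :: "'a rel"
  assumes "(u, v) \<in> R ^^ k" "u \<noteq> v"
  obtains w where "(u, w) \<in> R"
proof (cases k)
  case (Suc m)
  then show thesis using assms(1) relpow_Suc_D2 that by metis
qed (use assms in auto)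

text \<open>\<open>K\<close> inherits connectedness: a walk of \<open>G\<close> from
  \<open>u\<close> to another vertex of \<open>K\<close> is matched by a walk of \<open>K\<close>,
  and the first arc of that walk leads to \<open>w\<close>.\<close>

lemma neighbour_in_isometric_subgraph:
  assumes "pair_graph G" "Digraph_Component.connected (with_proj G)" "isometric_subgraph K G"
    and "2 \<le> card (pverts K)" "u \<in> pverts K"
  obtains w where "(u, w) \<in> parcs K"
proof -
  have "\<not> pverts K \<subseteq> {u}"
    using assms(4) card_mono[of "{u}" "pverts K"] by auto
  then obtain v where v: "v \<in> pverts K" "v \<noteq> u" by blast
  moreover have "pverts K \<subseteq> pverts G"
    using assms(1,3) by (simp add: isometric_subgraph_iff)
  ultimately obtain k where "(u, v) \<in> parcs G ^^ k"
    using assms(1,2,5) unfolding connected_iff_relpow[OF assms(1)] by blast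
  then obtain j where "(u, v) \<in> parcs K ^^ j"
    using assms(3,5) v(1) unfolding isometric_subgraph_iff[OF assms(1)] by blast
  with v that show thesis by (metis ex_neighbour)
qed

section \<open>Projecting and lifting walks\<close>

lemma pverts_lex_product [simp]: "pverts (lex_product G H) = pverts G \<times> pverts H"
  by (simp add: lex_product_def)

lemma in_parcs_lex_product:
  "((u, x), (v, y)) \<in> parcs (lex_product G H) \<longleftrightarrow>
    u \<in> pverts G \<and> x \<in> pverts H \<and> v \<in> pverts G \<and> y \<in> pverts H \<and>
    ((u, v) \<in> parcs G \<or> (x, y) \<in> parcs H \<and> u = v)"
  by (auto simp: lex_product_def)

text \<open>Steps inside a fibre of \<open>fst\<close> are dropped, which is why the length may
  decrease. General relations let the lemma serve both the product and its subgraphs.\<close>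

lemma project_relpow:
  fixes E :: "'a rel" and F :: "('a \<times> 'b) rel"
  assumes "(p, q) \<in> F ^^ k"
    and "\<And>u x v y. ((u, x), (v, y)) \<in> F \<Longrightarrow> u = v \<or> (u, v) \<in> E"
  shows "\<exists>j\<le>k. (fst p, fst q) \<in> E ^^ j"
  using assms(1)
proof (induction k arbitrary: q)
  case 0
  then show ?case by auto
next
  case (Suc k)
  then obtain r where r: "(p, r) \<in> F ^^ k" "(r, q) \<in> F" by auto
  obtain j where j: "j \<le> k" "(fst p, fst r) \<in> E ^^ j"
    using Suc.IH r(1) by blast
  have "fst r = fst q \<or> (fst r, fst q) \<in> E"
    using assms(2)[of "fst r" "snd r" "fst q" "snd q"] r(2) by simp
  then show ?case
  proof
    assume "fst r = fst q"
    then show ?thesis using j by (intro exI[of _ j]) auto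
  next
    assume "(fst r, fst q) \<in> E"
    then show ?thesis using j by (intro exI[of _ "Suc j"]) auto
  qed
qed

text \<open>Arcs of \<open>E\<close> lift to all pairs of vertices of \<open>W\<close> above their
  ends, so a walk lifts by choosing any vertex of \<open>W\<close> above each inner vertex. Distinct
  ends guarantee a last arc; an empty walk could not change \<open>x\<close> into
  \<open>y\<close>.\<close>

lemma lift_relpow:
  fixes E :: "'a rel" and F :: "('a \<times> 'b) rel"
  assumes "(u, v) \<in> E ^^ k" "u \<noteq> v"
    and "\<And>p q. p \<in> W \<Longrightarrow> q \<in> W \<Longrightarrow> (fst p, fst q) \<in> E \<Longrightarrow> (p, q) \<in> F"
    and "E \<subseteq> fst ` W \<times> fst ` W" "(u, x) \<in> W" "(v, y) \<in> W"
  shows "((u, x), (v, y)) \<in> F ^^ k"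
proof -
  have walk: "\<exists>q\<in>W. fst q = w \<and> ((u, x), q) \<in> F ^^ m" if "(u, w) \<in> E ^^ m" for w m
    using that
  proof (induction m arbitrary: w)
    case 0
    then show ?case using assms(5) by force
  next
    case (Suc m)
    then obtain w' where w': "(u, w') \<in> E ^^ m" "(w', w) \<in> E" by auto
    then obtain q where "q \<in> W" "fst q = w'" "((u, x), q) \<in> F ^^ m"
      using Suc.IH by blast
    moreover obtain q' where "q' \<in> W" "fst q' = w"
      using assms(4) w'(2) by force
    ultimately show ?case
      using assms(3) w'(2) by (metis relpow_Suc_I)
  qed
  \<comment> \<open>\<open>walk\<close> does not control which vertex above its end is reached. It
    is therefore used only up to the last arc, which is then aimed at \<open>(v, y)\<close>.\<close>
  obtain m where m: "k = Suc m"
    using assms(1,2) by (cases k) auto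
  then obtain w where "(u, w) \<in> E ^^ m" "(w, v) \<in> E"
    using assms(1) by auto
  with walk[of w m] assms(3)[of _ "(v, y)"] assms(6) show ?thesis
    unfolding m by (metis fst_conv relpow_Suc_I)
qed

text \<open>A walk of \<open>G\<close> is lifted to the whole product, replaced by a walk of
  \<open>K\<close> that is no longer, and projected back.\<close>

lemma isometric_subgraph_project:
  assumes G: "pair_graph G" and H: "pair_graph H"
    and K: "isometric_subgraph K (lex_product G H)"
  shows "isometric_subgraph (induced G (fst ` pverts K)) G"
proof (rule isometric_subgraph_inducedI[OF G])
  interpret G: pair_graph G by fact
  note K' = K[unfolded isometric_subgraph_iff[OF pair_graph_lex_product[OF G H]]]
  then interpret K: pair_graph K by blast
  let ?S = "fst ` pverts K"
  have sub: "pverts K \<subseteq> pverts G \<times> pverts H" using K' by simp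
  then show "?S \<subseteq> pverts G" by auto
  fix u v k
  assume uv: "u \<in> ?S" "v \<in> ?S" "u \<noteq> v" and walk: "(u, v) \<in> parcs G ^^ k"
  then obtain x y where xy: "(u, x) \<in> pverts K" "(v, y) \<in> pverts K" by auto
  \<comment> \<open>The vertex \<open>x\<close> shows that \<open>H\<close> is nonempty, so every
    fibre is nonempty and the whole vertex set can serve as \<open>W\<close>.\<close>
  have "fst ` (pverts G \<times> pverts H) = pverts G"
    using xy sub by (intro fst_image_times[THEN trans]) auto
  then have "((u, x), (v, y)) \<in> parcs (lex_product G H) ^^ k"
    using xy sub
    by (intro lift_relpow[OF walk uv(3), where W = "pverts G \<times> pverts H"])
      (auto simp: in_parcs_lex_product G.in_arcsD1 G.in_arcsD2)
  then obtain i where i: "i \<le> k" "((u, x), (v, y)) \<in> parcs K ^^ i"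
    using K' xy by blast
  have "\<exists>j\<le>i. (fst (u, x), fst (v, y)) \<in> (parcs G \<inter> ?S \<times> ?S) ^^ j"
  proof (rule project_relpow[OF i(2)])
    fix u x v y
    assume e: "((u, x), (v, y)) \<in> parcs K"
    then have "((u, x), (v, y)) \<in> parcs (lex_product G H)" using K' by blast
    moreover have "u \<in> ?S" "v \<in> ?S"
      using K.in_arcsD1[OF e] K.in_arcsD2[OF e] by force+
    ultimately show "u = v \<or> (u, v) \<in> parcs G \<inter> ?S \<times> ?S"
      by (auto simp: in_parcs_lex_product)
  qed
  then show "\<exists>j\<le>k. (u, v) \<in> (parcs G \<inter> ?S \<times> ?S) ^^ j"
    using i(1) by (auto intro: le_trans)
qed

text \<open>Between different fibres a walk is projected to \<open>G\<close>, replaced by one of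
  \<open>K\<close>, and lifted into \<open>W\<close>. Within one fibre a detour through a
  neighbouring fibre has length 2; the bound on \<open>card (pverts K)\<close> provides that
  neighbour.\<close>

lemma isometric_subgraph_lift:
  assumes G: "pair_graph G" and H: "pair_graph H"
    and conn: "Digraph_Component.connected (with_proj G)"
    and K: "isometric_subgraph K G" and card: "2 \<le> card (pverts K)"
    and W: "W \<subseteq> pverts K \<times> pverts H" "fst ` W = pverts K"
  shows "isometric_subgraph (induced (lex_product G H) W) (lex_product G H)"
proof (rule isometric_subgraph_inducedI[OF pair_graph_lex_product[OF G H]])
  note K' = K[unfolded isometric_subgraph_iff[OF G]]
  then interpret K: pair_graph K by blast
  let ?E = "parcs (lex_product G H)"
  let ?F = "?E \<inter> W \<times> W"
  show "W \<subseteq> pverts (lex_product G H)"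
    using W(1) K' by auto
  have lift_arc: "(p, q) \<in> ?F" if "p \<in> W" "q \<in> W" "(fst p, fst q) \<in> parcs K" for p q
    using that W(1) K' by (cases p; cases q) (auto simp: in_parcs_lex_product)
  fix p q k
  assume pq: "p \<in> W" "q \<in> W" "p \<noteq> q" and walk: "(p, q) \<in> ?E ^^ k"
  obtain u x v y where eqs: "p = (u, x)" "q = (v, y)" by fastforce
  have uv: "u \<in> pverts K" "v \<in> pverts K" using pq W(1) eqs by auto
  show "\<exists>j\<le>k. (p, q) \<in> ?F ^^ j"
  proof (cases "u = v")
    case False
    obtain i where i: "i \<le> k" "(u, v) \<in> parcs G ^^ i"
      using project_relpow[OF walk, of "parcs G"] by (auto simp: in_parcs_lex_product eqs)
    then obtain j where j: "j \<le> i" "(u, v) \<in> parcs K ^^ j"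
      using K' uv by blast
    have "parcs K \<subseteq> fst ` W \<times> fst ` W"
      unfolding W(2) by (auto dest: K.in_arcsD1 K.in_arcsD2)
    then have "(p, q) \<in> ?F ^^ j"
      unfolding eqs using pq eqs by (intro lift_relpow[OF j(2) False lift_arc]) auto
    then show ?thesis using i(1) j(1) le_trans by blast
  next
    case True
    obtain w where w: "(u, w) \<in> parcs K"
      using neighbour_in_isometric_subgraph[OF G conn K card uv(1)] .
    then obtain r where r: "r \<in> W" "fst r = w"
      using W(2) K.in_arcsD2 by (metis imageE)
    have "(p, r) \<in> ?F" "(r, q) \<in> ?F"
      using w r pq eqs True K.arcs_symmetric[OF w] by (simp_all only: lift_arc fst_conv)
    then have two: "(p, q) \<in> ?F ^^ 2"
      by (auto simp: numeral_2_eq_2)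
    \<comment> \<open>A walk too short for the detour is a single arc, as \<open>p\<close> and
      \<open>q\<close> differ, and the induced subgraph keeps this arc.\<close>
    consider "k = 0" | "k = 1" | "2 \<le> k" by linarith
    then show ?thesis
    proof cases
      case 1
      then show ?thesis using walk pq by auto
    next
      case 2
      then show ?thesis using walk pq by (intro exI[of _ 1]) auto
    next
      case 3
      then show ?thesis using two by blast
    qed
  qed
qed

text \<open>Walks of \<open>G\<close> lift between different fibres, and two vertices above the same
  \<open>u\<close> are joined through the fibre of a neighbour of \<open>u\<close>.\<close>

lemma connected_lex_product:
  assumes G: "pair_graph G" and H: "pair_graph H"
    and conn: "Digraph_Component.connected (with_proj G)"
    and card: "2 \<le> card (pverts G)" and ne: "pverts H \<noteq> {}"
  shows "Digraph_Component.connected (with_proj (lex_product G H))"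
proof -
  interpret G: pair_graph G by fact
  let ?E = "parcs (lex_product G H)"
  have diff: "\<exists>k. ((u, x), (v, y)) \<in> ?E ^^ k"
    if uv: "u \<in> pverts G" "v \<in> pverts G" "x \<in> pverts H" "y \<in> pverts H" "u \<noteq> v" for u v x y
  proof -
    obtain k where "(u, v) \<in> parcs G ^^ k"
      using conn uv by (auto simp: connected_iff_relpow[OF G])
    then have "((u, x), (v, y)) \<in> ?E ^^ k"
      using uv
      by (intro lift_relpow[where W = "pverts G \<times> pverts H"])
        (auto simp: in_parcs_lex_product dest: G.in_arcsD1 G.in_arcsD2)
    then show ?thesis ..
  qed
  have "\<exists>k. ((u, x), (v, y)) \<in> ?E ^^ k"
    if uv: "u \<in> pverts G" "v \<in> pverts G" "x \<in> pverts H" "y \<in> pverts H" for u v x y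
  proof (cases "u = v")
    case True
    obtain w where w: "(u, w) \<in> parcs G"
      using neighbour_in_isometric_subgraph[OF G conn isometric_subgraph_refl[OF G] card uv(1)] .
    then have w': "w \<in> pverts G" "(w, u) \<in> parcs G"
      by (auto dest: G.in_arcsD2 G.arcs_symmetric)
    have "((u, x), (w, x)) \<in> ?E" "((w, x), (v, y)) \<in> ?E"
      using w w' uv True by (auto simp: in_parcs_lex_product)
    then have "((u, x), (v, y)) \<in> ?E ^^ 2"
      by (auto simp: numeral_2_eq_2)
    then show ?thesis ..
  qed (use diff uv in blast)
  moreover have "pverts G \<noteq> {}" using card by auto
  ultimately show ?thesis
    using ne by (simp add: connected_iff_relpow[OF pair_graph_lex_product[OF G H]])
qed

section \<open>Orders of isometric subgraphs of the product\<close>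

text \<open>The section \<open>S \<times> {t}\<close> already projects onto \<open>S\<close>; it is
  enlarged inside \<open>S \<times> T\<close> to the required size.\<close>

lemma ex_subset_projecting_onto:
  assumes "finite S" "finite T" "T \<noteq> {}" "card S \<le> k" "k \<le> card S * card T"
  shows "\<exists>W. W \<subseteq> S \<times> T \<and> fst ` W = S \<and> card W = k"
proof -
  obtain t where t: "t \<in> T" using assms(3) by blast
  have "\<exists>W. S \<times> {t} \<subseteq> W \<and> W \<subseteq> S \<times> T \<and> card W = k"
    using assms t by (intro exists_subset_between) (auto simp: card_cartesian_product)
  then obtain W where "S \<times> {t} \<subseteq> W" "W \<subseteq> S \<times> T" "card W = k" by blast
  moreover from this have "fst ` W = S" by force
  ultimately show ?thesis by blast
qed

text \<open>For a subgraph whose projection has \<open>a\<close> vertices, each of the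
  \<open>a\<close> fibres it meets contains between 1 and \<open>card (pverts H)\<close> of its
  vertices. Conversely, all totals in this range are realised by choosing how much of each fibre to
  take.\<close>

lemma dp_set_lex_product:
  assumes G: "pair_graph G" and H: "pair_graph H"
    and conn: "Digraph_Component.connected (with_proj G)"
    and card: "2 \<le> card (pverts G)" and ne: "pverts H \<noteq> {}"
  shows "k \<in> dp_set (lex_product G H) \<longleftrightarrow> (\<exists>a\<in>dp_set G. a \<le> k \<and> k \<le> a * card (pverts H))"
proof
  interpret H: pair_graph H by fact
  assume "k \<in> dp_set (lex_product G H)"
  then obtain K where K: "isometric_subgraph K (lex_product G H)" "card (pverts K) = k" "1 \<le> k"
    by (rule dp_setE)
  let ?S = "fst ` pverts K"
  have fin: "finite (pverts K)" "pverts K \<noteq> {}"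
    using K by (auto intro: card_ge_0_finite)
  have sub: "pverts K \<subseteq> ?S \<times> pverts H"
    using K(1) by (force simp: isometric_subgraph_iff[OF pair_graph_lex_product[OF G H]])
  have "card ?S \<in> dp_set G"
    using isometric_subgraph_project[OF G H K(1)] fin
    by (rule_tac dp_setI) (auto simp: Suc_le_eq card_gt_0_iff)
  moreover have "card ?S \<le> k"
    using card_image_le[OF fin(1)] K(2) by blast
  moreover have "k \<le> card ?S * card (pverts H)"
    using card_mono[OF _ sub] fin(1) H.pair_finite_verts K(2) by (simp add: card_cartesian_product)
  ultimately show "\<exists>a\<in>dp_set G. a \<le> k \<and> k \<le> a * card (pverts H)" by blast
next
  interpret H: pair_graph H by fact
  assume "\<exists>a\<in>dp_set G. a \<le> k \<and> k \<le> a * card (pverts H)"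
  then obtain a where a: "a \<in> dp_set G" "a \<le> k" "k \<le> a * card (pverts H)" by blast
  have Gne: "pverts G \<noteq> {}" using card by auto
  have lift: "k \<in> dp_set (lex_product G H)"
    if b: "b \<in> dp_set G" "2 \<le> b" "b \<le> k" "k \<le> b * card (pverts H)" for b
  proof -
    obtain K where K: "isometric_subgraph K G" "card (pverts K) = b"
      using b(1) by (rule dp_setE)
    then have "finite (pverts K)" using b(2) by (intro card_ge_0_finite) simp
    then obtain W where "W \<subseteq> pverts K \<times> pverts H" "fst ` W = pverts K" "card W = k"
      using ex_subset_projecting_onto[of "pverts K" "pverts H" k] H.pair_finite_verts ne b K by auto
    then show ?thesis
      using isometric_subgraph_lift[OF G H conn K(1)] b K(2) by (intro dp_setI) auto
  qed
  \<comment> \<open>A one-vertex isometric subgraph cannot be blown up in this way; an edge serves instead.\<close>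
  consider "k = 1" | "2 \<le> k" "a = 1" | "2 \<le> a"
    using a(1,2) by (auto simp: dp_set_def) linarith
  then show "k \<in> dp_set (lex_product G H)"
  proof cases
    case 1
    then show ?thesis
      using one_in_dp_set[OF pair_graph_lex_product[OF G H]] Gne ne by simp
  next
    case 2
    obtain u where "u \<in> pverts G" using Gne by blast
    then obtain v where "(u, v) \<in> parcs G"
      using neighbour_in_isometric_subgraph[OF G conn isometric_subgraph_refl[OF G] card] by blast
    \<comment> \<open>Here \<open>k\<close> is at most \<open>card (pverts H)\<close>, hence at most
      twice that, so \<open>lift\<close> applies with \<open>b = 2\<close>.\<close>
    then show ?thesis
      using lift[OF two_in_dp_set[OF G]] 2 a(3) by simp
  next
    case 3
    then show ?thesis using lift a by blast
  qed
qed

text \<open>Only the interval of the largest element of \<open>D\<close> up to \<open>k\<close>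
  matters: right ends increase with \<open>a\<close>, and later intervals start after
  \<open>k\<close>. The first number it can miss is \<open>a * n + 1\<close>, which explains the
  offset.\<close>

lemma intervals_cover_iff_gaps:
  fixes D :: "nat set"
  assumes D: "1 \<in> D" "N \<in> D" "\<And>a. a \<in> D \<Longrightarrow> 1 \<le> a \<and> a \<le> N" and n: "1 \<le> n"
  shows "(\<forall>k. 1 \<le> k \<and> k \<le> N * n \<longrightarrow> (\<exists>a\<in>D. a \<le> k \<and> k \<le> a * n)) \<longleftrightarrow>
    (\<forall>a b. a \<in> D \<and> b \<in> D \<and> a < b \<and> {a<..<b} \<noteq> {} \<and> {a<..<b} \<inter> D = {} \<longrightarrow> b \<le> a * n + 1)"
    (is "?cover \<longleftrightarrow> ?gaps")
proof
  assume cover: ?cover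
  show ?gaps
  proof (intro allI impI)
    fix a b
    assume ab: "a \<in> D \<and> b \<in> D \<and> a < b \<and> {a<..<b} \<noteq> {} \<and> {a<..<b} \<inter> D = {}"
    show "b \<le> a * n + 1"
    proof (rule ccontr)
      assume less: "\<not> b \<le> a * n + 1"
      \<comment> \<open>The covering is tested at \<open>a * n + 1\<close>, which is less than
        \<open>b\<close> and so lies in the required range. The covering element \<open>c\<close> is
        below \<open>b\<close>, hence at most \<open>a\<close> because of the gap, and its interval
        then ends too early.\<close>
      have "b \<le> N" using D(3) ab by blast
      also have "N \<le> N * n" using n by simp
      finally obtain c where c: "c \<in> D" "c \<le> a * n + 1" "a * n + 1 \<le> c * n"
        using cover less by (metis le_add2 linear order_trans)
      have "c \<le> a"
        using ab c(1,2) less by (metis IntI empty_iff greaterThanLessThan_iff le_less_trans not_le)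
      then have "c * n \<le> a * n" by simp
      with c(3) show False by simp
    qed
  qed
next
  assume gaps: ?gaps
  show ?cover
  proof (intro allI impI)
    fix k
    assume k: "1 \<le> k \<and> k \<le> N * n"
    have fin: "finite D" using D(3) finite_subset[of D "{..N}"] by auto
    define a where "a = Max {d \<in> D. d \<le> k}"
    have "a \<in> {d \<in> D. d \<le> k}"
      unfolding a_def using fin D(1) k by (intro Max_in) auto
    then have a: "a \<in> D" "a \<le> k" by auto
    have a_max: "d \<le> a" if "d \<in> D" "d \<le> k" for d
      unfolding a_def using fin that by (intro Max_ge) auto
    have "k \<le> a * n"
    proof (rule ccontr)
      assume *: "\<not> k \<le> a * n"
      have "a \<le> a * n" using n by simp
      with * have "a < k" by linarith
      \<comment> \<open>This makes the set defining \<open>b\<close> nonempty: from \<open>N\<close>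
        on, the interval \<open>{N..N * n}\<close> would already contain \<open>k\<close>.\<close>
      have "k < N"
      proof (rule ccontr)
        assume "\<not> k < N"
        then have "N \<le> a" using a_max D(2) by simp
        then have "N * n \<le> a * n" by simp
        with * k show False by simp
      qed
      define b where "b = Min {d \<in> D. k < d}"
      have "b \<in> {d \<in> D. k < d}"
        unfolding b_def using fin D(2) \<open>k < N\<close> by (intro Min_in) auto
      then have b: "b \<in> D" "k < b" by auto
      have b_min: "b \<le> d" if "d \<in> D" "k < d" for d
        unfolding b_def using fin that by (intro Min_le) auto
      have "{a<..<b} \<inter> D = {}"
        using a_max b_min by (force simp: not_le)
      \<comment> \<open>The uncovered \<open>k\<close> itself witnesses that the gap between
        \<open>a\<close> and \<open>b\<close> is nonempty.\<close>
      moreover have "k \<in> {a<..<b}" using \<open>a < k\<close> b(2) by simp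
      ultimately have "b \<le> a * n + 1"
        using gaps a(1) b(1) by (metis empty_iff greaterThanLessThan_iff less_trans)
      with * b(2) show False by simp
    qed
    with a show "\<exists>a\<in>D. a \<le> k \<and> k \<le> a * n" by blast
  qed
qed

theorem theorem3p2:
  fixes G :: "'a pair_pre_digraph" and H :: "'b pair_pre_digraph" and n :: nat
  assumes "pair_graph G" and "Digraph_Component.connected (with_proj G)" and "card (pverts G) \<ge> 2"
    and "pair_graph H" and "pverts H \<noteq> {}" and "card (pverts H) = n"
  shows "distance_preserving (lex_product G H) \<longleftrightarrow>
    (\<forall>a b. bounds_non_dp_interval G a b \<longrightarrow> b \<le> a * n + 1)"
proof -
  interpret G: pair_graph G by fact
  interpret H: pair_graph H by fact
  let ?N = "card (pverts G)"
  have Gne: "pverts G \<noteq> {}" using assms(3) by auto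
  have "1 \<le> n" using assms(5,6) H.pair_finite_verts by (auto simp: Suc_le_eq card_gt_0_iff)
  \<comment> \<open>The product is connected whatever the gaps of \<open>dp_set G\<close> are, so
    only the orders of its isometric subgraphs remain.\<close>
  have "distance_preserving (lex_product G H) \<longleftrightarrow>
      (\<forall>k. 1 \<le> k \<and> k \<le> ?N * n \<longrightarrow> k \<in> dp_set (lex_product G H))"
    using connected_lex_product[OF assms(1,4,2,3,5)] assms(6)
    by (auto simp: distance_preserving_def dp_set_def card_cartesian_product)
  also have "\<dots> \<longleftrightarrow> (\<forall>k. 1 \<le> k \<and> k \<le> ?N * n \<longrightarrow> (\<exists>a\<in>dp_set G. a \<le> k \<and> k \<le> a * n))"
    using dp_set_lex_product[OF assms(1,4,2,3,5)] assms(6) by simp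
  also have "\<dots> \<longleftrightarrow> (\<forall>a b. bounds_non_dp_interval G a b \<longrightarrow> b \<le> a * n + 1)"
    unfolding bounds_non_dp_interval_def
  proof (rule intervals_cover_iff_gaps)
    show "1 \<in> dp_set G" "?N \<in> dp_set G"
      using one_in_dp_set[OF assms(1) Gne] card_verts_in_dp_set[OF assms(1) Gne] .
    show "1 \<le> a \<and> a \<le> ?N" if "a \<in> dp_set G" for a
      using dp_set_le_card[OF assms(1) that] that by (simp add: dp_set_def)
  qed fact
  finally show ?thesis .
qed

end
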